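(* Suppose $\mathcal{B}$ is a bornology on a metric space $(X,d)$ with a closed base. Then the finest locally convex topology $\tau_F$ for $(C(X),\tau_{\mathcal{B}}^s)$ coincides with its weak topology if and only if $\mathcal{B}=\mathcal{F}$, where $\mathcal{F}$ is the bornology of all finite subsets of $X$.
   Context: $C(X)$ is the real vector space of all real-valued continuous functions on the metric space $(X,d)$. A bornology on $X$ is a family of nonempty subsets of $X$ that covers $X$ and is closed under finite unions and under taking (nonempty) subsets of its members. A closed base for $\mathcal{B}$ is a subfamily $\mathcal{B}_0\subseteq\mathcal{B}$ of closed sets that is cofinal in $\mathcal{B}$ under inclusion. An extended seminorm on a vector space is a $[0,\infty]$-valued absolutely homogeneous (with $0\cdot\infty=0$) subadditive map; a vector space with a group topology induced by a family of extended seminorms is an extended locally convex space (elcs). The topology $\tau_{\mathcal{B}}^s$ of strong uniform convergence on $\mathcal{B}$ is the topology on $C(X)$ induced by the extended seminorms $\rho_B^s(f)=\inf_{\delta>0}\{\sup_{x\in B^\delta}|f(x)|\}$, $B\in\mathcal{B}_0$, where $B^\delta=\{x\in X:d(x,y)<\delta\text{ for some }y\in B\}$; $(C(X),\tau_{\mathcal{B}}^s)$ is an elcs. For an elcs $(Y,\tau)$, the finest locally convex topology (flc topology) $\tau_F$ is the finest locally convex topology on $Y$ (i.e. one induced by finite-valued seminorms) that is coarser than $\tau$; the weak topology is the one induced by the seminorms $y\mapsto|f(y)|$ where $f$ ranges over all $\tau$-continuous linear functionals on $Y$. *)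

theory Defs
  imports "HOL-Analysis.Analysis"
begin

section \<open>Extended seminorms and the topologies they induce\<close>

text \<open>In \<^typ>\<open>ennreal\<close> we have \<open>0 * \<infinity> = 0\<close>, as the convention for absolute homogeneity requires.\<close>

definition extended_seminorm :: "('v::real_vector \<Rightarrow> ennreal) \<Rightarrow> bool" where
  "extended_seminorm p \<longleftrightarrow>
     (\<forall>c x. p (c *\<^sub>R x) = ennreal \<bar>c\<bar> * p x) \<and> (\<forall>x y. p (x + y) \<le> p x + p y)"

definition finite_seminorm :: "('v::real_vector \<Rightarrow> ennreal) \<Rightarrow> bool" where
  "finite_seminorm p \<longleftrightarrow> extended_seminorm p \<and> (\<forall>x. p x < \<infinity>)"

text \<open>The group topology in which the finite intersections of the sets \<open>{z. p z < \<epsilon>}\<close> with \<open>p \<in> P\<close>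
  and \<open>\<epsilon> > 0\<close> form a base of neighbourhoods of the origin. For empty \<open>P\<close> it is the indiscrete
  topology.\<close>

definition seminorm_topology :: "('v::real_vector \<Rightarrow> ennreal) set \<Rightarrow> 'v topology" where
  "seminorm_topology P = topology (\<lambda>U. \<forall>x\<in>U. \<exists>F \<epsilon>. finite F \<and> F \<subseteq> P \<and> (0::real) < \<epsilon> \<and>
     {y. \<forall>p\<in>F. p (y - x) < ennreal \<epsilon>} \<subseteq> U)"

lemma openin_seminorm_topology:
  "openin (seminorm_topology P) U \<longleftrightarrow>
     (\<forall>x\<in>U. \<exists>F \<epsilon>. finite F \<and> F \<subseteq> P \<and> 0 < \<epsilon> \<and> {y. \<forall>p\<in>F. p (y - x) < ennreal \<epsilon>} \<subseteq> U)"
proof -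
  have "istopology (\<lambda>U. \<forall>x\<in>U. \<exists>F \<epsilon>. finite F \<and> F \<subseteq> P \<and> 0 < \<epsilon> \<and>
          {y. \<forall>p\<in>F. p (y - x) < ennreal \<epsilon>} \<subseteq> U)" (is "istopology ?O")
    unfolding istopology_def
  proof (intro conjI allI impI)
    fix S T assume S: "?O S" and T: "?O T"
    show "?O (S \<inter> T)"
    proof
      fix x assume x: "x \<in> S \<inter> T"
      obtain F e where F: "finite F" "F \<subseteq> P" "0 < e" "{y. \<forall>p\<in>F. p (y - x) < ennreal e} \<subseteq> S"
        using bspec[OF S, of x] x by auto
      obtain G d where G: "finite G" "G \<subseteq> P" "0 < d" "{y. \<forall>p\<in>G. p (y - x) < ennreal d} \<subseteq> T"
        using bspec[OF T, of x] x by auto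
      have "z < ennreal e \<and> z < ennreal d" if "z < ennreal (min d e)" for z
        using that by (meson ennreal_leI min.cobounded1 min.cobounded2 less_le_trans)
      then have "{y. \<forall>p\<in>F \<union> G. p (y - x) < ennreal (min d e)}
          \<subseteq> {y. \<forall>p\<in>F. p (y - x) < ennreal e} \<inter> {y. \<forall>p\<in>G. p (y - x) < ennreal d}"
        by blast
      then have "{y. \<forall>p\<in>F \<union> G. p (y - x) < ennreal (min d e)} \<subseteq> S \<inter> T"
        using F(4) G(4) by blast
      moreover have "finite (F \<union> G)" "F \<union> G \<subseteq> P" "0 < min d e"
        using F G by auto
      ultimately show "\<exists>F \<epsilon>. finite F \<and> F \<subseteq> P \<and> 0 < \<epsilon> \<and>
          {y. \<forall>p\<in>F. p (y - x) < ennreal \<epsilon>} \<subseteq> S \<inter> T"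
        by blast
    qed
  next
    fix K assume K: "\<forall>S\<in>K. ?O S"
    show "?O (\<Union>K)"
    proof
      fix x assume "x \<in> \<Union>K"
      then obtain S where "S \<in> K" "x \<in> S" by blast
      with K show "\<exists>F \<epsilon>. finite F \<and> F \<subseteq> P \<and> 0 < \<epsilon> \<and>
          {y. \<forall>p\<in>F. p (y - x) < ennreal \<epsilon>} \<subseteq> \<Union>K"
        by (meson Union_upper subset_trans)
    qed
  qed
  then show ?thesis
    unfolding seminorm_topology_def by (simp add: topology_inverse')
qed

lemma topspace_seminorm_topology [simp]: "topspace (seminorm_topology P) = UNIV"
proof -
  have "openin (seminorm_topology P) UNIV"
    unfolding openin_seminorm_topology by (intro ballI exI[of _ "{}"] exI[of _ 1]) simp
  from openin_subset[OF this] show ?thesis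
    by (simp add: top.extremum_unique)
qed

definition elcs :: "('v::real_vector) topology \<Rightarrow> bool" where
  "elcs \<tau> \<longleftrightarrow> (\<exists>P. (\<forall>p\<in>P. extended_seminorm p) \<and> \<tau> = seminorm_topology P)"

definition locally_convex_topology :: "('v::real_vector) topology \<Rightarrow> bool" where
  "locally_convex_topology \<tau> \<longleftrightarrow> (\<exists>P. (\<forall>p\<in>P. finite_seminorm p) \<and> \<tau> = seminorm_topology P)"

definition coarser :: "'v topology \<Rightarrow> 'v topology \<Rightarrow> bool" where
  "coarser \<sigma> \<tau> \<longleftrightarrow> (\<forall>U. openin \<sigma> U \<longrightarrow> openin \<tau> U)"


section \<open>The finest locally convex topology and the weak topology\<close>

definition is_flc_topology :: "('v::real_vector) topology \<Rightarrow> 'v topology \<Rightarrow> bool" where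
  "is_flc_topology \<tau> \<sigma> \<longleftrightarrow> locally_convex_topology \<sigma> \<and> coarser \<sigma> \<tau> \<and>
     (\<forall>\<sigma>'. locally_convex_topology \<sigma>' \<and> coarser \<sigma>' \<tau> \<longrightarrow> coarser \<sigma>' \<sigma>)"

definition flc_topology :: "('v::real_vector) topology \<Rightarrow> 'v topology" where
  "flc_topology \<tau> = (THE \<sigma>. is_flc_topology \<tau> \<sigma>)"

definition weak_topology :: "('v::real_vector) topology \<Rightarrow> 'v topology" where
  "weak_topology \<tau> =
     seminorm_topology {\<lambda>y. ennreal \<bar>f y\<bar> | f. linear f \<and> continuous_map \<tau> euclideanreal f}"

lemma openin_seminorm_ball:
  assumes p: "extended_seminorm p" "p \<in> P"
  shows "openin (seminorm_topology P) {y. p (y - x) < ennreal e}"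
  unfolding openin_seminorm_topology
proof
  fix u assume "u \<in> {y. p (y - x) < ennreal e}"
  then have u: "p (u - x) < ennreal e" by simp
  then obtain r where r: "p (u - x) = ennreal r" "0 \<le> r" "r < e"
    by (cases "p (u - x)") (auto simp: ennreal_less_iff)
  have "{y. \<forall>q\<in>{p}. q (y - u) < ennreal (e - r)} \<subseteq> {y. p (y - x) < ennreal e}"
  proof clarsimp
    fix y assume y: "p (y - u) < ennreal (e - r)"
    have "p (y - x) = p ((y - u) + (u - x))" by simp
    also have "\<dots> \<le> p (y - u) + p (u - x)"
      using p(1) unfolding extended_seminorm_def by blast
    also have "\<dots> < ennreal (e - r) + ennreal r"
      using y r(1) by (simp add: ennreal_add_left_cancel_less add.commute)
    also have "\<dots> = ennreal e"
      using r by (simp flip: ennreal_plus)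
    finally show "p (y - x) < ennreal e" .
  qed
  then show "\<exists>F \<epsilon>. finite F \<and> F \<subseteq> P \<and> 0 < \<epsilon> \<and>
      {y. \<forall>q\<in>F. q (y - u) < ennreal \<epsilon>} \<subseteq> {y. p (y - x) < ennreal e}"
    using p(2) r(3) by (intro exI[of _ "{p}"] exI[of _ "e - r"]) auto
qed

lemma coarser_antisym: "coarser \<sigma> \<tau> \<Longrightarrow> coarser \<tau> \<sigma> \<Longrightarrow> \<sigma> = \<tau>"
  unfolding coarser_def topology_eq by blast

lemma coarser_seminorm_topology:
  assumes "topspace \<tau> = UNIV" "\<And>p x e. p \<in> P \<Longrightarrow> 0 < e \<Longrightarrow> openin \<tau> {y. p (y - x) < ennreal e}"
    and P0: "\<And>p. p \<in> P \<Longrightarrow> extended_seminorm p"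
  shows "coarser (seminorm_topology P) \<tau>"
  unfolding coarser_def
proof (intro allI impI)
  fix U assume U: "openin (seminorm_topology P) U"
  show "openin \<tau> U"
  proof (subst openin_subopen, intro ballI)
    fix x assume x: "x \<in> U"
    obtain F e where F: "finite F" "F \<subseteq> P" "0 < e" "{y. \<forall>p\<in>F. p (y - x) < ennreal e} \<subseteq> U"
      using bspec[OF U[unfolded openin_seminorm_topology] x] by auto
    let ?V = "{y. \<forall>p\<in>F. p (y - x) < ennreal e}"
    have "openin \<tau> ((\<Inter>p\<in>F. {y. p (y - x) < ennreal e}) \<inter> topspace \<tau>)"
      by (rule openin_INT) (use F assms(2) in auto)
    moreover have "(\<Inter>p\<in>F. {y. p (y - x) < ennreal e}) \<inter> topspace \<tau> = ?V"
      using assms(1) by auto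
    moreover have "x \<in> ?V"
    proof clarsimp
      fix p assume "p \<in> F"
      then have "p (0 *\<^sub>R x) = ennreal \<bar>0\<bar> * p x"
        using P0 F(2) unfolding extended_seminorm_def by blast
      then show "p 0 < ennreal e" using F(3) by simp
    qed
    ultimately show "\<exists>T. openin \<tau> T \<and> x \<in> T \<and> T \<subseteq> U"
      using F(4) by (intro exI[of _ ?V] conjI) (simp_all only:)
  qed
qed

lemma ex1_flc_topology:
  assumes "topspace \<tau> = UNIV"
  shows "\<exists>!\<sigma>. is_flc_topology \<tau> \<sigma>"
proof (rule ex_ex1I)
  let ?P = "{p. finite_seminorm p \<and> (\<forall>x e. 0 < e \<longrightarrow> openin \<tau> {y. p (y - x) < ennreal e})}"
  have "coarser (seminorm_topology ?P) \<tau>"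
    using assms by (intro coarser_seminorm_topology) (auto simp: finite_seminorm_def)
  moreover have "coarser \<sigma>' (seminorm_topology ?P)"
    if lc: "locally_convex_topology \<sigma>'" and co: "coarser \<sigma>' \<tau>" for \<sigma>'
  proof -
    obtain Q where Q: "\<And>p. p \<in> Q \<Longrightarrow> finite_seminorm p" "\<sigma>' = seminorm_topology Q"
      using lc unfolding locally_convex_topology_def by blast
    have QP: "Q \<subseteq> ?P"
    proof
      fix p assume p: "p \<in> Q"
      then have "extended_seminorm p" using Q(1) finite_seminorm_def by blast
      then have "openin \<sigma>' {y. p (y - x) < ennreal e}" for x e
        unfolding Q(2) using p by (rule openin_seminorm_ball)
      then show "p \<in> ?P"
        using Q(1)[OF p] co by (simp add: coarser_def)
    qed
    show ?thesis
      unfolding Q(2)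
    proof (rule coarser_seminorm_topology)
      show "openin (seminorm_topology ?P) {y. p (y - x) < ennreal e}" if "p \<in> Q" for p x e
        using that QP Q(1)[OF that] unfolding finite_seminorm_def
        by (intro openin_seminorm_ball) auto
    qed (use Q(1) in \<open>simp_all add: finite_seminorm_def\<close>)
  qed
  moreover have "locally_convex_topology (seminorm_topology ?P)"
    unfolding locally_convex_topology_def by (intro exI[of _ ?P]) simp
  ultimately have "is_flc_topology \<tau> (seminorm_topology ?P)"
    unfolding is_flc_topology_def by simp
  then show "\<exists>\<sigma>. is_flc_topology \<tau> \<sigma>" ..
next
  show "\<sigma> = \<sigma>'" if "is_flc_topology \<tau> \<sigma>" "is_flc_topology \<tau> \<sigma>'" for \<sigma> \<sigma>'
    using that coarser_antisym unfolding is_flc_topology_def by blast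
qed

lemma is_flc_topology_flc_topology:
  assumes "topspace \<tau> = UNIV"
  shows "is_flc_topology \<tau> (flc_topology \<tau>)"
  unfolding flc_topology_def by (rule theI'[OF ex1_flc_topology[OF assms]])


section \<open>Bornologies\<close>

definition bornology :: "'a set set \<Rightarrow> bool" where
  "bornology \<B> \<longleftrightarrow> {} \<notin> \<B> \<and> \<Union>\<B> = UNIV \<and> (\<forall>A\<in>\<B>. \<forall>B\<in>\<B>. A \<union> B \<in> \<B>) \<and>
     (\<forall>B\<in>\<B>. \<forall>A. A \<subseteq> B \<and> A \<noteq> {} \<longrightarrow> A \<in> \<B>)"

definition closed_base :: "'a::metric_space set set \<Rightarrow> 'a set set \<Rightarrow> bool" where
  "closed_base \<B> \<B>\<^sub>0 \<longleftrightarrow> \<B>\<^sub>0 \<subseteq> \<B> \<and> (\<forall>B\<in>\<B>\<^sub>0. closed B) \<and> (\<forall>B\<in>\<B>. \<exists>C\<in>\<B>\<^sub>0. B \<subseteq> C)"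

definition finite_bornology :: "'a set set" where
  "finite_bornology = {B. finite B \<and> B \<noteq> {}}"


section \<open>The space of all continuous real functions, with strong uniform convergence\<close>

typedef (overloaded) ('a::topological_space) cfun = "{f :: 'a \<Rightarrow> real. continuous_on UNIV f}"
  morphisms apply_cfun Abs_cfun
  by (rule exI[of _ "\<lambda>_. 0"]) simp

setup_lifting type_definition_cfun

instantiation cfun :: (topological_space) real_vector
begin

lift_definition zero_cfun :: "'a cfun" is "\<lambda>_. 0" by simp

lift_definition plus_cfun :: "'a cfun \<Rightarrow> 'a cfun \<Rightarrow> 'a cfun" is "\<lambda>f g x. f x + g x"
  by (intro continuous_intros)

lift_definition uminus_cfun :: "'a cfun \<Rightarrow> 'a cfun" is "\<lambda>f x. - f x"
  by (intro continuous_intros)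

lift_definition minus_cfun :: "'a cfun \<Rightarrow> 'a cfun \<Rightarrow> 'a cfun" is "\<lambda>f g x. f x - g x"
  by (intro continuous_intros)

lift_definition scaleR_cfun :: "real \<Rightarrow> 'a cfun \<Rightarrow> 'a cfun" is "\<lambda>c f x. c * f x"
  by (intro continuous_intros)

instance
  by standard (transfer; simp add: fun_eq_iff algebra_simps)+

end

definition enlargement :: "'a::metric_space set \<Rightarrow> real \<Rightarrow> 'a set" where
  "enlargement B \<delta> = {x. \<exists>y\<in>B. dist x y < \<delta>}"

definition strong_seminorm :: "'a::metric_space set \<Rightarrow> 'a cfun \<Rightarrow> ennreal" where
  "strong_seminorm B f = (INF \<delta>\<in>{0<..}. SUP x\<in>enlargement B \<delta>. ennreal \<bar>apply_cfun f x\<bar>)"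

definition strong_uniform_topology :: "'a::metric_space set set \<Rightarrow> 'a cfun topology" where
  "strong_uniform_topology \<B>\<^sub>0 = seminorm_topology (strong_seminorm ` \<B>\<^sub>0)"

lemma extended_seminorm_strong_seminorm: "extended_seminorm (strong_seminorm B)"
  unfolding extended_seminorm_def
proof (intro conjI allI)
  have ge: "ennreal \<bar>c\<bar> * strong_seminorm B f \<le> strong_seminorm B (c *\<^sub>R f)" for c and f :: "'a cfun"
    unfolding strong_seminorm_def scaleR_cfun.rep_eq abs_mult ennreal_mult[OF abs_ge_zero abs_ge_zero]
      SUP_mult_left_ennreal[symmetric]
    by (intro INF_greatest mult_left_mono INF_lower) auto
  fix c and f :: "'a cfun"
  show "strong_seminorm B (c *\<^sub>R f) = ennreal \<bar>c\<bar> * strong_seminorm B f"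
  proof (cases "c = 0")
    case True
    have "strong_seminorm B (0 *\<^sub>R f) \<le> (SUP x\<in>enlargement B 1. ennreal \<bar>apply_cfun (0 *\<^sub>R f) x\<bar>)"
      unfolding strong_seminorm_def by (rule INF_lower) auto
    also have "\<dots> \<le> 0"
      unfolding scaleR_cfun.rep_eq by (rule SUP_least) simp
    finally show ?thesis using True by simp
  next
    case False
    have "strong_seminorm B (c *\<^sub>R f)
        = ennreal \<bar>c\<bar> * (ennreal \<bar>inverse c\<bar> * strong_seminorm B (c *\<^sub>R f))"
      using False by (simp add: mult.assoc[symmetric] ennreal_mult[symmetric] abs_mult[symmetric])
    also have "\<dots> \<le> ennreal \<bar>c\<bar> * strong_seminorm B (inverse c *\<^sub>R (c *\<^sub>R f))"
      by (intro mult_left_mono ge) auto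
    finally show ?thesis using ge[of c f] False by (intro antisym) auto
  qed
next
  fix f g :: "'a cfun"
  let ?S = "\<lambda>h \<delta>. SUP x\<in>enlargement B \<delta>. ennreal \<bar>apply_cfun h x\<bar>"
  have mono: "?S h a \<le> ?S h b" if "a \<le> b" for h :: "'a cfun" and a b
    using that by (intro SUP_subset_mono) (force simp: enlargement_def)+
  have sub: "?S (f + g) \<delta> \<le> ?S f \<delta> + ?S g \<delta>" for \<delta>
  proof (rule SUP_least)
    fix x assume x: "x \<in> enlargement B \<delta>"
    have "ennreal \<bar>apply_cfun (f + g) x\<bar> \<le> ennreal \<bar>apply_cfun f x\<bar> + ennreal \<bar>apply_cfun g x\<bar>"
      by (simp add: plus_cfun.rep_eq ennreal_leI flip: ennreal_plus)
    also have "\<dots> \<le> ?S f \<delta> + ?S g \<delta>"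
      using x by (intro add_mono SUP_upper)
    finally show "ennreal \<bar>apply_cfun (f + g) x\<bar> \<le> ?S f \<delta> + ?S g \<delta>" .
  qed
  have le: "strong_seminorm B (f + g) \<le> ?S f a + ?S g b" if "0 < a" "0 < b" for a b
  proof -
    have "strong_seminorm B (f + g) \<le> ?S (f + g) (min a b)"
      unfolding strong_seminorm_def using that by (intro INF_lower) auto
    also have "\<dots> \<le> ?S f (min a b) + ?S g (min a b)" by (rule sub)
    also have "\<dots> \<le> ?S f a + ?S g b" by (intro add_mono mono) auto
    finally show ?thesis .
  qed
  show "strong_seminorm B (f + g) \<le> strong_seminorm B f + strong_seminorm B g"
  proof (rule ennreal_le_epsilon)
    fix e :: real
    assume fin: "strong_seminorm B f + strong_seminorm B g < top" and e: "0 < e"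
    have "strong_seminorm B f < strong_seminorm B f + ennreal (e / 2)"
      "strong_seminorm B g < strong_seminorm B g + ennreal (e / 2)"
      using fin e by (cases "strong_seminorm B f"; cases "strong_seminorm B g";
          simp add: ennreal_less_iff flip: ennreal_plus)+
    then obtain a b where ab: "0 < a" "?S f a < strong_seminorm B f + ennreal (e / 2)"
        "0 < b" "?S g b < strong_seminorm B g + ennreal (e / 2)"
      unfolding strong_seminorm_def INF_less_iff by auto
    have "strong_seminorm B (f + g) \<le> ?S f a + ?S g b"
      using le ab by blast
    also have "\<dots> \<le> (strong_seminorm B f + ennreal (e / 2)) + (strong_seminorm B g + ennreal (e / 2))"
      using ab by (intro add_mono) auto
    also have "\<dots> = strong_seminorm B f + strong_seminorm B g + (ennreal (e / 2) + ennreal (e / 2))"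
      by (simp add: ac_simps)
    also have "ennreal (e / 2) + ennreal (e / 2) = ennreal e"
      using e by (simp flip: ennreal_plus)
    finally show "strong_seminorm B (f + g) \<le> strong_seminorm B f + strong_seminorm B g + ennreal e" .
  qed
qed

lemma elcs_strong_uniform_topology: "elcs (strong_uniform_topology \<B>\<^sub>0)"
  unfolding elcs_def strong_uniform_topology_def
  using extended_seminorm_strong_seminorm by blast

end

theory Submission
  imports Defs
begin

text \<open>Comparing the two topologies amounts to asking which finite seminorms that are continuous for
  \<open>\<tau> = strong_uniform_topology \<B>\<^sub>0\<close> are controlled by finitely many \<open>\<tau>\<close>-continuous functionals.

  If every member of \<open>\<B>\<close> is finite, the supremum over a small enlargement of \<open>B\<close> is governed by
  the values on \<open>B\<close> itself, so \<open>\<tau>\<close> is the topology of pointwise convergence. It is generated by the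
  evaluations, which are continuous functionals; hence \<open>\<tau>\<close> is its own weak topology, is therefore
  locally convex, and is its own finest locally convex topology.

  If \<open>\<B>\<close> has an infinite member, some \<open>B \<in> \<B>\<^sub>0\<close> is infinite. Project linearly onto the subspace
  where \<open>\<rho> = strong_seminorm B\<close> is finite (\<open>linear_projection_onto_subspace\<close>) and compose with
  \<open>\<rho>\<close>. The result \<open>p\<close> is a finite seminorm below \<open>\<rho>\<close>, since \<open>p\<close> agrees with \<open>\<rho>\<close> where the
  latter is finite; so \<open>p\<close> is continuous for the finest locally convex topology. Were it continuous
  for the weak topology, it would vanish on the common kernel of some \<open>n\<close> functionals
  (\<open>seminorm_vanishes_on_common_kernel\<close>). But \<open>n + 1\<close> bumps at points of \<open>B\<close> span an
  \<open>n + 1\<close>-dimensional space of bounded functions (\<open>exists_dual_family\<close>), which meets that kernel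
  in a nonzero function (\<open>exists_nonzero_in_common_kernel\<close>); such a function is nonzero at
  one of the chosen points, so \<open>p\<close> does not vanish on it.\<close>

section \<open>Seminorms and linear functionals\<close>

lemma extended_seminorm_zero: "extended_seminorm p \<Longrightarrow> p 0 = 0"
  unfolding extended_seminorm_def by (metis abs_zero ennreal_0 mult_zero_left scale_zero_left)

lemma subspace_finite_extended_seminorm:
  assumes "extended_seminorm p"
  shows "subspace {x. p x < \<infinity>}"
proof (rule subspaceI)
  show "0 \<in> {x. p x < \<infinity>}"
    using extended_seminorm_zero[OF assms] by simp
  fix x y assume "x \<in> {x. p x < \<infinity>}" "y \<in> {x. p x < \<infinity>}"
  moreover have "p (x + y) \<le> p x + p y"
    using assms unfolding extended_seminorm_def by blast
  ultimately show "x + y \<in> {x. p x < \<infinity>}"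
    by (auto simp: less_top[symmetric] top_unique)
next
  fix c x assume "x \<in> {x. p x < \<infinity>}"
  then show "c *\<^sub>R x \<in> {x. p x < \<infinity>}"
    using assms unfolding extended_seminorm_def by (simp add: ennreal_mult_less_top)
qed

lemma openin_dominated_seminorm_ball:
  assumes p: "extended_seminorm p" and q: "q \<in> P" "\<And>x. p x \<le> q x"
  shows "openin (seminorm_topology P) {y. p (y - x) < ennreal e}" (is "openin _ ?U")
  unfolding openin_seminorm_topology
proof
  fix u assume "u \<in> ?U"
  moreover have "openin (seminorm_topology {p}) ?U"
    using p by (rule openin_seminorm_ball) simp
  ultimately obtain F d where F: "F \<subseteq> {p}" "0 < d" "{y. \<forall>r\<in>F. r (y - u) < ennreal d} \<subseteq> ?U"
    unfolding openin_seminorm_topology by auto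
  have "{y. \<forall>r\<in>{q}. r (y - u) < ennreal d} \<subseteq> {y. \<forall>r\<in>F. r (y - u) < ennreal d}"
    using F(1) q(2) by (auto intro: le_less_trans)
  with F q(1) show "\<exists>F \<epsilon>. finite F \<and> F \<subseteq> P \<and> 0 < \<epsilon> \<and>
      {y. \<forall>p\<in>F. p (y - u) < ennreal \<epsilon>} \<subseteq> ?U"
    by (intro exI[of _ "{q}"] exI[of _ d]) auto
qed

lemma finite_seminorm_abs_linear:
  assumes "linear f"
  shows "finite_seminorm (\<lambda>y. ennreal \<bar>f y\<bar>)"
  using assms unfolding finite_seminorm_def extended_seminorm_def
  by (auto simp: linear_scale linear_add abs_mult ennreal_mult ennreal_leI simp flip: ennreal_plus)

text \<open>This is how point evaluations, which are dominated by the strong seminorm of any set containing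
  the point, are seen to be continuous.\<close>

lemma continuous_map_dominated_linear:
  fixes f :: "'v::real_vector \<Rightarrow> real"
  assumes f: "linear f" and q: "q \<in> P" "\<And>x. ennreal \<bar>f x\<bar> \<le> q x"
  shows "continuous_map (seminorm_topology P) euclideanreal f"
  unfolding continuous_map_def
proof (intro conjI allI impI)
  fix U :: "real set" assume U: "openin euclideanreal U"
  have "openin (seminorm_topology P) {y. f y \<in> U}"
  proof (subst openin_subopen, intro ballI)
    fix x assume "x \<in> {y. f y \<in> U}"
    then obtain e where e: "0 < e" "ball (f x) e \<subseteq> U"
      using U by (auto simp: open_contains_ball)
    have "{y. ennreal \<bar>f (y - x)\<bar> < ennreal e} \<subseteq> {y. f y \<in> U}"
      using e f by (auto simp: linear_diff dist_real_def ennreal_less_iff subset_iff abs_minus_commute)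
    moreover have "openin (seminorm_topology P) {y. ennreal \<bar>f (y - x)\<bar> < ennreal e}"
      using openin_dominated_seminorm_ball[of "\<lambda>y. ennreal \<bar>f y\<bar>"] finite_seminorm_abs_linear[OF f] q
      unfolding finite_seminorm_def by blast
    moreover have "x \<in> {y. ennreal \<bar>f (y - x)\<bar> < ennreal e}"
      using e f by (simp add: linear_0)
    ultimately show "\<exists>T. openin (seminorm_topology P) T \<and> x \<in> T \<and> T \<subseteq> {y. f y \<in> U}"
      by blast
  qed
  then show "openin (seminorm_topology P) {x \<in> topspace (seminorm_topology P). f x \<in> U}"
    by simp
qed simp

lemma locally_convex_weak_topology: "locally_convex_topology (weak_topology \<tau>)"
  unfolding locally_convex_topology_def weak_topology_def
  by (rule exI, rule conjI[OF _ refl]) (auto intro: finite_seminorm_abs_linear)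

lemma coarser_weak_topology:
  assumes "topspace \<tau> = UNIV"
  shows "coarser (weak_topology \<tau>) \<tau>"
  unfolding weak_topology_def
proof (rule coarser_seminorm_topology[OF assms])
  fix p x and e :: real
  assume "p \<in> {\<lambda>y. ennreal \<bar>f y\<bar> |f. linear f \<and> continuous_map \<tau> euclideanreal f}" and "0 < e"
  then obtain f where f: "p = (\<lambda>y. ennreal \<bar>f y\<bar>)" "linear f" "continuous_map \<tau> euclideanreal f"
    by blast
  have "{y. p (y - x) < ennreal e} = {y \<in> topspace \<tau>. f y \<in> ball (f x) e}"
    using assms f \<open>0 < e\<close>
    by (auto simp: linear_diff dist_real_def ennreal_less_iff abs_minus_commute)
  then show "openin \<tau> {y. p (y - x) < ennreal e}"
    using openin_continuous_map_preimage[OF f(3), of "ball (f x) e"] by simp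
qed (auto dest: finite_seminorm_abs_linear simp: finite_seminorm_def)

text \<open>A neighbourhood of the origin cut out by functionals contains their common kernel, and a
  seminorm bounded on a subspace is zero there by homogeneity.\<close>

lemma seminorm_vanishes_on_common_kernel:
  fixes p :: "'v::real_vector \<Rightarrow> ennreal"
  assumes p: "finite_seminorm p" and U: "openin (weak_topology \<tau>) {y. p y < 1}"
  obtains \<Phi> :: "('v \<Rightarrow> real) set" where "finite \<Phi>" "\<And>f. f \<in> \<Phi> \<Longrightarrow> linear f"
    "\<And>v. (\<And>f. f \<in> \<Phi> \<Longrightarrow> f v = 0) \<Longrightarrow> p v = 0"
proof -
  let ?L = "{f. linear f \<and> continuous_map \<tau> euclideanreal f}"
  let ?s = "\<lambda>f y. ennreal \<bar>f y :: real\<bar>"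
  have hom: "p (c *\<^sub>R x) = ennreal \<bar>c\<bar> * p x" for c x
    using p unfolding finite_seminorm_def extended_seminorm_def by blast
  have "0 \<in> {y. p y < 1}"
    using p extended_seminorm_zero[of p] by (simp add: finite_seminorm_def)
  moreover have "weak_topology \<tau> = seminorm_topology (?s ` ?L)"
    unfolding weak_topology_def by (rule arg_cong[of _ _ seminorm_topology]) auto
  ultimately have "\<exists>F e. finite F \<and> F \<subseteq> ?s ` ?L \<and> 0 < e \<and>
      {y. \<forall>q\<in>F. q (y - 0) < ennreal e} \<subseteq> {y. p y < 1}"
    using U by (simp only: openin_seminorm_topology)
  then obtain F e where F: "finite F" "F \<subseteq> ?s ` ?L" "0 < e"
      "{y. \<forall>q\<in>F. q (y - 0) < ennreal e} \<subseteq> {y. p y < 1}"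
    by blast
  obtain \<Phi> where \<Phi>: "\<Phi> \<subseteq> ?L" "finite \<Phi>" "F = ?s ` \<Phi>"
    using finite_subset_image[OF F(1,2)] by blast
  have "p v = 0" if v: "\<And>f. f \<in> \<Phi> \<Longrightarrow> f v = 0" for v
  proof -
    have small: "p (c *\<^sub>R v) < 1" for c
    proof -
      have "ennreal \<bar>f (c *\<^sub>R v)\<bar> < ennreal e" if f: "f \<in> \<Phi>" for f
      proof -
        have "f (c *\<^sub>R v) = 0"
          using v[OF f] \<Phi>(1) f linear_scale[of f c v] by auto
        with F(3) show ?thesis by simp
      qed
      then have "c *\<^sub>R v \<in> {y. \<forall>q\<in>F. q (y - 0) < ennreal e}"
        using \<Phi>(3) by simp
      with F(4) show ?thesis by blast
    qed
    obtain r where r: "p v = ennreal r" "0 \<le> r"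
      using p unfolding finite_seminorm_def by (metis ennreal_cases infinity_ennreal_def less_irrefl)
    show ?thesis
    proof (cases "r = 0")
      case False
      then have "p ((1 / r) *\<^sub>R v) = 1"
        using r by (simp add: hom flip: ennreal_mult)
      with small[of "1 / r"] show ?thesis by simp
    qed (use r in simp)
  qed
  with that[of \<Phi>] \<Phi> show thesis by blast
qed


section \<open>Linear algebra\<close>

text \<open>A Hamel basis of \<open>S\<close> supplies the projection; no continuity is claimed for it. It serves to
  replace an extended seminorm by a finite one.\<close>

lemma linear_projection_onto_subspace:
  fixes S :: "'v::real_vector set"
  assumes "subspace S"
  obtains \<pi> :: "'v \<Rightarrow> 'v" where "linear \<pi>" "\<And>x. \<pi> x \<in> S" "\<And>x. x \<in> S \<Longrightarrow> \<pi> x = x"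
proof -
  obtain E where E: "E \<subseteq> S" "independent E" "S \<subseteq> span E"
    by (rule basis_exists[of S])
  then have S: "S = span E"
    using assms by (metis span_minimal subset_antisym)
  obtain \<pi> where \<pi>: "linear \<pi>" "\<forall>x\<in>E. \<pi> x = id x" "range \<pi> = span (id ` E)"
    using linear_independent_extend_subspace[OF E(2), of id] by blast
  have "\<pi> x = id x" if "x \<in> S" for x
    using linear_eq_on_span[OF \<pi>(1) linear_id] \<pi>(2) that S by blast
  moreover have "\<pi> x \<in> S" for x
    using \<pi>(3) S by auto
  ultimately show thesis
    using that[of \<pi>] \<pi>(1) by simp
qed

text \<open>Each further functional lowers the dimension by at most one: where it does not vanish
  identically, its kernel together with a single vector outside it spans everything.\<close>

lemma span_of_trivial_common_kernel:
  fixes \<Phi> :: "('v::real_vector \<Rightarrow> real) set"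
  assumes "finite \<Phi>" "\<And>f. f \<in> \<Phi> \<Longrightarrow> linear f" "subspace V"
    and "\<And>v. v \<in> V \<Longrightarrow> (\<And>f. f \<in> \<Phi> \<Longrightarrow> f v = 0) \<Longrightarrow> v = 0"
  shows "\<exists>T. finite T \<and> card T \<le> card \<Phi> \<and> V \<subseteq> span T"
  using assms
proof (induction \<Phi> arbitrary: V rule: finite_induct)
  case empty
  then show ?case by (intro exI[of _ "{}"]) auto
next
  case (insert g \<Phi>)
  have g: "linear g" using insert.prems(1) by simp
  let ?W = "V \<inter> {v. g v = 0}"
  have "subspace ?W"
    using insert.prems(2) g by (auto simp: subspace_def linear_0 linear_add linear_scale)
  then obtain T where T: "finite T" "card T \<le> card \<Phi>" "?W \<subseteq> span T"
    using insert.IH[OF _ \<open>subspace ?W\<close>] insert.prems(1,3) by fastforce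
  show ?case
  proof (cases "V \<subseteq> ?W")
    case True
    then show ?thesis using T insert.hyps by (intro exI[of _ T]) auto
  next
    case False
    then obtain w where w: "w \<in> V" "g w \<noteq> 0" by auto
    have "v \<in> span (insert w T)" if v: "v \<in> V" for v
    proof -
      have "v - (g v / g w) *\<^sub>R w \<in> ?W"
        using insert.prems(2) g v w by (simp add: subspace_diff subspace_scale linear_diff linear_scale)
      then show ?thesis
        using T(3) by (auto simp: span_breakdown_eq)
    qed
    moreover have "card (insert w T) \<le> card (insert g \<Phi>)"
      using T insert.hyps card_insert_le_m1[of "card (insert g \<Phi>)" T w] by simp
    ultimately show ?thesis using T(1) by (intro exI[of _ "insert w T"]) auto
  qed
qed

lemma exists_nonzero_in_common_kernel:
  fixes \<Phi> :: "('v::real_vector \<Rightarrow> real) set"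
  assumes "finite \<Phi>" "\<And>f. f \<in> \<Phi> \<Longrightarrow> linear f" "independent S" "card \<Phi> < card S"
  obtains v where "v \<in> span S" "v \<noteq> 0" "\<And>f. f \<in> \<Phi> \<Longrightarrow> f v = 0"
proof (rule ccontr)
  assume "\<not> thesis"
  then have "\<exists>T. finite T \<and> card T \<le> card \<Phi> \<and> span S \<subseteq> span T"
    using that by (intro span_of_trivial_common_kernel assms(1,2) subspace_span) blast+
  then obtain T where "finite T" "card T \<le> card \<Phi>" "span S \<subseteq> span T"
    by blast
  then have "card S \<le> card \<Phi>"
    using independent_span_bound[OF _ assms(3), of T] span_superset[of S] by fastforce
  with assms(4) show False by simp
qed


section \<open>Continuous functions and the strong seminorms\<close>

lemma linear_apply_cfun: "linear (\<lambda>f. apply_cfun f x)"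
  by (rule linearI) (simp_all add: plus_cfun.rep_eq scaleR_cfun.rep_eq)

lemma apply_cfun_le_strong_seminorm:
  assumes "x \<in> B"
  shows "ennreal \<bar>apply_cfun f x\<bar> \<le> strong_seminorm B f"
  unfolding strong_seminorm_def
  by (rule INF_greatest, rule SUP_upper) (use assms in \<open>auto simp: enlargement_def intro!: bexI[of _ x]\<close>)

lemma strong_seminorm_finite_of_bounded:
  assumes "\<And>x. \<bar>apply_cfun f x\<bar> \<le> c"
  shows "strong_seminorm B f < \<infinity>"
proof -
  have "strong_seminorm B f \<le> (SUP x\<in>enlargement B 1. ennreal \<bar>apply_cfun f x\<bar>)"
    unfolding strong_seminorm_def by (rule INF_lower) simp
  also have "\<dots> \<le> ennreal c"
    by (rule SUP_least) (simp add: assms ennreal_leI)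
  finally show ?thesis
    using ennreal_less_top[of c] by (simp add: le_less_trans)
qed

text \<open>Strictness leaves room for an intermediate bound, and continuity carries that bound from the
  finite set to an enlargement of it.\<close>

lemma strong_seminorm_less_iff_finite:
  fixes B :: "'a::metric_space set"
  assumes "finite B" "0 < e"
  shows "strong_seminorm B f < ennreal e \<longleftrightarrow> (\<forall>x\<in>B. \<bar>apply_cfun f x\<bar> < e)"
proof
  assume "strong_seminorm B f < ennreal e"
  then have "ennreal \<bar>apply_cfun f x\<bar> < ennreal e" if "x \<in> B" for x
    using apply_cfun_le_strong_seminorm[OF that, of f] by (rule le_less_trans[rotated])
  then show "\<forall>x\<in>B. \<bar>apply_cfun f x\<bar> < e"
    by (simp add: ennreal_less_iff)
next
  assume *: "\<forall>x\<in>B. \<bar>apply_cfun f x\<bar> < e"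
  \<comment> \<open>The extra \<open>0\<close> keeps the maximum meaningful for empty \<open>B\<close>.\<close>
  define m where "m = Max (insert 0 ((\<lambda>x. \<bar>apply_cfun f x\<bar>) ` B))"
  have "m < e"
    unfolding m_def using assms * by (subst Max_less_iff) auto
  then obtain d where d: "m < d" "d < e" using dense by blast
  have B: "B \<subseteq> {x. \<bar>apply_cfun f x\<bar> < d}"
    using d(1) assms(1) unfolding m_def by (auto simp: Max_less_iff)
  have "continuous_on UNIV (apply_cfun f)" using apply_cfun[of f] by simp
  then have "open {x. \<bar>apply_cfun f x\<bar> < d}"
    by (intro open_Collect_less continuous_intros)
  with assms(1) B obtain r where r: "0 < r" "(\<Union>x\<in>B. ball x r) \<subseteq> {x. \<bar>apply_cfun f x\<bar> < d}"
    using compact_subset_open_imp_ball_epsilon_subset[OF finite_imp_compact] by metis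
  have "strong_seminorm B f \<le> (SUP x\<in>enlargement B r. ennreal \<bar>apply_cfun f x\<bar>)"
    unfolding strong_seminorm_def using r(1) by (intro INF_lower) simp
  also have "\<dots> \<le> ennreal d"
    using r(2) by (intro SUP_least ennreal_leI) (force simp: enlargement_def dist_commute)
  also have "\<dots> < ennreal e"
    using d(2) assms(2) by (simp add: ennreal_less_iff ennreal_lessI)
  finally show "strong_seminorm B f < ennreal e" .
qed

lemma exists_dual_family:
  fixes A :: "'a::metric_space set"
  assumes "finite A"
  obtains u :: "'a \<Rightarrow> 'a cfun" where "\<And>a x. \<bar>apply_cfun (u a) x\<bar> \<le> 1"
    "\<forall>a\<in>A. \<forall>b\<in>A. apply_cfun (u a) b = (if a = b then 1 else 0)"
proof -
  have "\<forall>a. \<exists>r>0. \<forall>x\<in>A. x \<noteq> a \<longrightarrow> r \<le> dist a x"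
    using finite_set_avoid[OF assms] by blast
  then obtain r where r: "\<And>a. 0 < r a" "\<And>a x. x \<in> A \<Longrightarrow> x \<noteq> a \<Longrightarrow> r a \<le> dist a x"
    by metis
  \<comment> \<open>The radius of the tent at \<open>a\<close> does not reach past the nearest other point of \<open>A\<close>.\<close>
  define u where "u a = Abs_cfun (\<lambda>x. max 0 (1 - dist a x / r a))" for a
  have u: "apply_cfun (u a) x = max 0 (1 - dist a x / r a)" for a x
    unfolding u_def using r(1)[of a]
    by (subst Abs_cfun_inverse) (auto intro!: continuous_intros)
  show thesis
  proof
    show "\<bar>apply_cfun (u a) x\<bar> \<le> 1" for a x
      using r(1)[of a] by (auto simp: u max_def)
    have "apply_cfun (u a) b = (if a = b then 1 else 0)" if "b \<in> A" for a b
      using r(1)[of a] r(2)[OF that, of a] by (auto simp: u max_def field_simps)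
    then show "\<forall>a\<in>A. \<forall>b\<in>A. apply_cfun (u a) b = (if a = b then 1 else 0)" by simp
  qed
qed

text \<open>Why the bumps span a space of full dimension on which the values at \<open>A\<close> determine a function:
  evaluating at \<open>a\<close> picks out the coefficient of \<open>u a\<close> in a linear combination.\<close>

lemma dual_family_independent_and_separated:
  fixes u :: "'a::metric_space \<Rightarrow> 'a cfun"
  assumes A: "finite A"
    and u: "\<forall>a\<in>A. \<forall>b\<in>A. apply_cfun (u a) b = (if a = b then 1 else 0)"
  shows "inj_on u A" and "independent (u ` A)"
    and "\<And>v. v \<in> span (u ` A) \<Longrightarrow> v \<noteq> 0 \<Longrightarrow> \<exists>a\<in>A. apply_cfun v a \<noteq> 0"
proof -
  show inj: "inj_on u A"
    by (rule inj_onI) (metis u zero_neq_one)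
  have coeff: "apply_cfun (\<Sum>w\<in>u ` A. c w *\<^sub>R w) a = c (u a)" if "a \<in> A" for c a
  proof -
    have "apply_cfun (\<Sum>w\<in>u ` A. c w *\<^sub>R w) a = (\<Sum>b\<in>A. c (u b) * apply_cfun (u b) a)"
      by (simp add: sum.reindex[OF inj] linear_sum[OF linear_apply_cfun] scaleR_cfun.rep_eq)
    also have "\<dots> = (\<Sum>b\<in>A. if b = a then c (u b) else 0)"
      using that by (intro sum.cong) (auto simp: u)
    finally show ?thesis using A that by simp
  qed
  have zero: "apply_cfun (0 :: 'a cfun) a = 0" for a
    by (simp add: zero_cfun.rep_eq)
  show "independent (u ` A)"
    by (rule independent_if_scalars_zero) (use A coeff zero in \<open>auto, metis\<close>)
  fix v assume "v \<in> span (u ` A)" "v \<noteq> 0"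
  then obtain c where c: "v = (\<Sum>w\<in>u ` A. c w *\<^sub>R w)"
    using span_finite[of "u ` A"] A by auto
  with \<open>v \<noteq> 0\<close> have "\<not> (\<forall>w\<in>u ` A. c w *\<^sub>R w = 0)"
    using sum.neutral[of "u ` A" "\<lambda>w. c w *\<^sub>R w"] by auto
  then obtain w where "w \<in> u ` A" "c w \<noteq> 0" by auto
  with c coeff show "\<exists>a\<in>A. apply_cfun v a \<noteq> 0" by auto
qed


section \<open>Comparison of the topologies\<close>

lemma topspace_strong_uniform_topology: "topspace (strong_uniform_topology \<B>\<^sub>0) = UNIV"
  by (simp add: strong_uniform_topology_def)

lemma strong_uniform_eq_weak_if_finite:
  fixes \<B>\<^sub>0 :: "'a::metric_space set set"
  assumes "\<And>B. B \<in> \<B>\<^sub>0 \<Longrightarrow> finite B"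
  shows "weak_topology (strong_uniform_topology \<B>\<^sub>0) = strong_uniform_topology \<B>\<^sub>0"
proof (rule coarser_antisym[OF coarser_weak_topology[OF topspace_strong_uniform_topology]])
  let ?\<tau> = "strong_uniform_topology \<B>\<^sub>0"
  have "coarser (seminorm_topology (strong_seminorm ` \<B>\<^sub>0)) (weak_topology ?\<tau>)"
  proof (rule coarser_seminorm_topology)
    show top: "topspace (weak_topology ?\<tau>) = UNIV"
      by (simp add: weak_topology_def)
    fix p and g :: "'a cfun" and e :: real
    assume "p \<in> strong_seminorm ` \<B>\<^sub>0" and e: "0 < e"
    then obtain B where B: "B \<in> \<B>\<^sub>0" "p = strong_seminorm B" by blast
    have "openin (weak_topology ?\<tau>) {f. ennreal \<bar>apply_cfun (f - g) x\<bar> < ennreal e}" if "x \<in> B" for x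
    proof -
      have "continuous_map ?\<tau> euclideanreal (\<lambda>f. apply_cfun f x)"
        unfolding strong_uniform_topology_def
        by (rule continuous_map_dominated_linear[OF linear_apply_cfun imageI[OF B(1)]])
          (rule apply_cfun_le_strong_seminorm[OF that])
      then show ?thesis
        unfolding weak_topology_def
        using linear_apply_cfun[of x] finite_seminorm_abs_linear[OF linear_apply_cfun[of x]]
        by (intro openin_seminorm_ball[of "\<lambda>f. ennreal \<bar>apply_cfun f x\<bar>"])
          (auto simp: finite_seminorm_def)
    qed
    then have "openin (weak_topology ?\<tau>)
        ((\<Inter>x\<in>B. {f. ennreal \<bar>apply_cfun (f - g) x\<bar> < ennreal e}) \<inter> topspace (weak_topology ?\<tau>))"
      using assms[OF B(1)] by (intro openin_INT) auto
    moreover have "(\<Inter>x\<in>B. {f. ennreal \<bar>apply_cfun (f - g) x\<bar> < ennreal e})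
        \<inter> topspace (weak_topology ?\<tau>) = {f. p (f - g) < ennreal e}"
      using strong_seminorm_less_iff_finite[OF assms[OF B(1)] e] top B(2)
      by (auto simp: ennreal_less_iff)
    ultimately show "openin (weak_topology ?\<tau>) {f. p (f - g) < ennreal e}" by simp
  qed (use extended_seminorm_strong_seminorm in blast)
  then show "coarser ?\<tau> (weak_topology ?\<tau>)"
    by (simp add: strong_uniform_topology_def)
qed

lemma flc_topology_eq_self:
  assumes "topspace \<tau> = UNIV" "locally_convex_topology \<tau>"
  shows "flc_topology \<tau> = \<tau>"
proof -
  have "is_flc_topology \<tau> \<tau>"
    using assms(2) by (simp add: is_flc_topology_def coarser_def)
  then show ?thesis
    by (rule ex1_flc_topology[OF assms(1), THEN the1_equality, folded flc_topology_def])
qed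

text \<open>The obstruction is a seminorm: the strong seminorm of an infinite \<open>B\<close>, made finite by a
  projection, has a kernel of infinite codimension.\<close>

lemma finite_if_flc_eq_weak:
  fixes B :: "'a::metric_space set"
  assumes eq: "flc_topology (strong_uniform_topology \<B>\<^sub>0) = weak_topology (strong_uniform_topology \<B>\<^sub>0)"
    and B: "B \<in> \<B>\<^sub>0"
  shows "finite B"
proof (rule ccontr)
  assume inf: "infinite B"
  let ?\<tau> = "strong_uniform_topology \<B>\<^sub>0"
  let ?\<rho> = "strong_seminorm B"
  have \<rho>: "extended_seminorm ?\<rho>" by (rule extended_seminorm_strong_seminorm)
  obtain \<pi> where \<pi>: "linear \<pi>" "\<And>f. ?\<rho> (\<pi> f) < \<infinity>" "\<And>f. ?\<rho> f < \<infinity> \<Longrightarrow> \<pi> f = f"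
    using linear_projection_onto_subspace[OF subspace_finite_extended_seminorm[OF \<rho>]] by auto
  define p where "p f = ?\<rho> (\<pi> f)" for f
  have p: "finite_seminorm p"
    using \<rho> \<pi>(1,2) unfolding finite_seminorm_def extended_seminorm_def p_def
    by (simp add: linear_add linear_scale)
  then have ext: "extended_seminorm p" by (simp add: finite_seminorm_def)
  have p_le: "p f \<le> ?\<rho> f" for f
    using \<pi>(3)[of f] unfolding p_def by (cases "?\<rho> f = \<infinity>") (auto simp: less_top)
  have "coarser (seminorm_topology {p}) ?\<tau>"
  proof (rule coarser_seminorm_topology[OF topspace_strong_uniform_topology])
    show "openin ?\<tau> {f. q (f - g) < ennreal e}" if "q \<in> {p}" for q g e
      unfolding strong_uniform_topology_def
      using openin_dominated_seminorm_ball[OF ext imageI[OF B], of strong_seminorm, OF p_le] that by simp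
  qed (use ext in simp)
  moreover have "locally_convex_topology (seminorm_topology {p})"
    unfolding locally_convex_topology_def using p by blast
  ultimately have "coarser (seminorm_topology {p}) (weak_topology ?\<tau>)"
    using is_flc_topology_flc_topology[OF topspace_strong_uniform_topology[of \<B>\<^sub>0]] eq
    unfolding is_flc_topology_def by metis
  moreover have "openin (seminorm_topology {p}) {f. p f < 1}"
    using openin_seminorm_ball[OF ext singletonI, of 0 1] by simp
  ultimately have "openin (weak_topology ?\<tau>) {f. p f < 1}"
    by (simp add: coarser_def)
  then obtain \<Phi> :: "('a cfun \<Rightarrow> real) set" where \<Phi>: "finite \<Phi>" "\<And>f. f \<in> \<Phi> \<Longrightarrow> linear f"
      "\<And>v. (\<And>f. f \<in> \<Phi> \<Longrightarrow> f v = 0) \<Longrightarrow> p v = 0"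
    using seminorm_vanishes_on_common_kernel[OF p] by metis
  obtain A where A: "A \<subseteq> B" "finite A" "card A = Suc (card \<Phi>)"
    using infinite_arbitrarily_large[OF inf] by blast
  obtain u where u: "\<And>a x. \<bar>apply_cfun (u a) x\<bar> \<le> 1"
      "\<forall>a\<in>A. \<forall>b\<in>A. apply_cfun (u a) b = (if a = b then 1 else 0)"
    using exists_dual_family[OF A(2)] by blast
  note dual = dual_family_independent_and_separated[OF A(2) u(2)]
  have "card \<Phi> < card (u ` A)"
    using dual(1) A(3) by (simp add: card_image)
  then obtain v where v: "v \<in> span (u ` A)" "v \<noteq> 0" "\<And>f. f \<in> \<Phi> \<Longrightarrow> f v = 0"
    using exists_nonzero_in_common_kernel[OF \<Phi>(1,2) dual(2)] by metis
  obtain a where a: "a \<in> A" "apply_cfun v a \<noteq> 0"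
    using dual(3)[OF v(1,2)] by blast
  \<comment> \<open>Bounded functions have finite \<open>\<rho>\<close>, so the projection fixes \<open>v\<close> and \<open>p v\<close> is really \<open>\<rho> v\<close>.\<close>
  have "u ` A \<subseteq> {f. ?\<rho> f < \<infinity>}"
    using strong_seminorm_finite_of_bounded[OF u(1)] by blast
  then have "?\<rho> v < \<infinity>"
    using v(1) span_minimal[OF _ subspace_finite_extended_seminorm[OF \<rho>]] by blast
  then have "p v = ?\<rho> v" by (simp add: p_def \<pi>(3))
  moreover have "p v = 0" using \<Phi>(3) v(3) by blast
  ultimately show False
    using apply_cfun_le_strong_seminorm[of a B v] a A(1) by (auto simp: ennreal_eq_0_iff)
qed

lemma finite_subset_in_bornology:
  assumes \<B>: "bornology \<B>" and A: "finite A" "A \<noteq> {}"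
  shows "A \<in> \<B>"
proof -
  have single: "{x} \<in> \<B>" for x
  proof -
    have "x \<in> \<Union>\<B>" using \<B> by (simp add: bornology_def)
    then obtain B where "B \<in> \<B>" "{x} \<subseteq> B" by auto
    with \<B> show ?thesis unfolding bornology_def by (meson insert_not_empty)
  qed
  have union: "C \<union> D \<in> \<B>" if "C \<in> \<B>" "D \<in> \<B>" for C D
    using \<B> that by (simp add: bornology_def)
  show ?thesis
    using A
  proof (induction A rule: finite_ne_induct)
    case (insert x F)
    then show ?case using union[OF single] by (metis insert_is_Un)
  qed (rule single)
qed

theorem theorem3p13:
  fixes \<B> \<B>\<^sub>0 :: "'a::metric_space set set"
  assumes "bornology \<B>" and "closed_base \<B> \<B>\<^sub>0"
  shows "flc_topology (strong_uniform_topology \<B>\<^sub>0) = weak_topology (strong_uniform_topology \<B>\<^sub>0)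
           \<longleftrightarrow> \<B> = finite_bornology"
proof
  assume eq: "flc_topology (strong_uniform_topology \<B>\<^sub>0) = weak_topology (strong_uniform_topology \<B>\<^sub>0)"
  have "finite B" if "B \<in> \<B>" for B
    using that assms(2) finite_if_flc_eq_weak[OF eq] unfolding closed_base_def
    by (meson finite_subset)
  moreover have "{} \<notin> \<B>" using assms(1) by (simp add: bornology_def)
  ultimately show "\<B> = finite_bornology"
    using finite_subset_in_bornology[OF assms(1)] unfolding finite_bornology_def by auto
next
  assume "\<B> = finite_bornology"
  then have "\<B>\<^sub>0 \<subseteq> finite_bornology"
    using assms(2) by (simp add: closed_base_def)
  then have "finite B" if "B \<in> \<B>\<^sub>0" for B
    using that by (auto simp: finite_bornology_def)
  then have weak: "weak_topology (strong_uniform_topology \<B>\<^sub>0) = strong_uniform_topology \<B>\<^sub>0"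
    by (rule strong_uniform_eq_weak_if_finite)
  then have "locally_convex_topology (strong_uniform_topology \<B>\<^sub>0)"
    using locally_convex_weak_topology by metis
  with weak show "flc_topology (strong_uniform_topology \<B>\<^sub>0) = weak_topology (strong_uniform_topology \<B>\<^sub>0)"
    using flc_topology_eq_self[OF topspace_strong_uniform_topology] by simp
qed

end
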